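(* Let $d,N\ge 1$ be integers and let $\kappa=(\nu,P,\tilde P,U)\in\mathcal K_d$, with $x,\tilde x,\mathbb I$, the bilinear form $\langle\,,\,\rangle$ on $V$ and $\mathcal P(\cdot,\cdot)$ as defined in the context. For $w=(w_0,w_1,\dots,w_d)$ write $w'=(w_1,\dots,w_d)$. Then for all $n,\tilde n\in\mathbb I$, $$\mathcal P(n',\tilde n')=\frac{1}{\nu^NN!}\langle x^n,\tilde x^{\tilde n}\rangle.$$
   Context: $\mathcal K_d$ is the set of 4-tuples $(\nu,P,\tilde P,U)$ where $\nu$ is a nonzero complex number and $P,\tilde P,U$ are $(d+1)\times(d+1)$ complex matrices (rows and columns indexed by $0,\dots,d$) such that: (i) $P=\mathrm{diag}(p_0,\dots,p_d)$ and $\tilde P=\mathrm{diag}(\tilde p_0,\dots,\tilde p_d)$ with $p_0=\tilde p_0=1/\nu$; (ii) $U=(u_{i,j})_{0\le i,j\le d}$ with $u_{0,j}=u_{j,0}=1$ for all $j=0,\dots,d$; (iii) $\nu PU\tilde PU^t=I_{d+1}$. (All $p_j,\tilde p_j$ are then nonzero.) Write $p=(p_0,\dots,p_d)$, $\tilde p=(\tilde p_0,\dots,\tilde p_d)$. Let $\tilde\theta\in\mathbb C$ be such that the matrix $R=\tilde\theta\tilde PU^t$ has $\det R=1$, and let $\theta=\nu/\tilde\theta$. Let $x=(x_0,\dots,x_d)$ be commuting variables and define $\tilde x=(\tilde x_0,\dots,\tilde x_d)$ by the row-vector equation $\tilde x=xR$. Multi-index notation: for $\lambda\in\mathbb N_0^{d+1}$,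 $x^\lambda=\prod_{i=0}^d x_i^{\lambda_i}$, $\lambda!=\prod_{i=0}^d\lambda_i!$, $|\lambda|=\sum_{i=0}^d\lambda_i$ (similarly for $\tilde x^\lambda,\tilde p^{\,\lambda}$). $\mathbb I=\{\lambda\in\mathbb N_0^{d+1}:|\lambda|=N\}$, and $V=\mathrm{span}_{\mathbb C}\{x^\lambda:\lambda\in\mathbb I\}$ is the space of homogeneous polynomials of total degree $N$ in $x_0,\dots,x_d$. The symmetric bilinear form $\langle\,,\,\rangle$ on $V$ is defined by $\langle x^n,x^m\rangle=\delta_{n,m}\frac{n!}{\tilde p^{\,n}}\theta^N$ for $n,m\in\mathbb I$. The multivariate Krawtchouk polynomials are defined, for $m=(m_1,\dots,m_d)$ and $\tilde m=(\tilde m_1,\dots,\tilde m_d)$ in $\mathbb N_0^d$ with $\sum m_i\le N$, $\sum\tilde m_i\le N$, by $$\mathcal P(m,\tilde m)=\sum_{A=(a_{i,j})\in\mathcal M_{d,N}}\frac{\prod_{j=1}^d(-m_j)_{\sum_{i=1}^da_{i,j}}\prod_{i=1}^d(-\tilde m_i)_{\sum_{j=1}^da_{i,j}}}{(-N)_{\sum_{i,j=1}^da_{i,j}}}\prod_{i,j=1}^d\frac{\omega_{i,j}^{a_{i,j}}}{a_{i,j}!},$$ where $\omega_{i,j}=1-u_{i,j}$, $\mathcal M_{d,N}$ is the set of $d\times d$ matrices with nonnegative integer entries whose sum is at most $N$, and $(a)_k=a(a+1)\cdots(a+k-1)$, $(a)_0=1$. *)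

theory Defs
  imports
    "HOL-Library.Poly_Mapping"
    "HOL-Library.FuncSet"
    "Jordan_Normal_Form.Determinant"
begin

text \<open>
  Matrices with rows and columns indexed by \<open>0, \<dots>, d\<close> are matrices in
  \<open>carrier_mat (d + 1) (d + 1)\<close>; their indexing is zero-based, so the entry \<open>(i, j)\<close> is
  \<open>U $$ (i, j)\<close> with no shift.
\<close>

definition krawtchouk_params ::
  "nat \<Rightarrow> (complex \<times> complex mat \<times> complex mat \<times> complex mat) set" where
  "krawtchouk_params d = {(\<nu>, P, Pt, U).
     \<nu> \<noteq> 0 \<and>
     P \<in> carrier_mat (d + 1) (d + 1) \<and>
     Pt \<in> carrier_mat (d + 1) (d + 1) \<and>
     U \<in> carrier_mat (d + 1) (d + 1) \<and>
     diagonal_mat P \<and> diagonal_mat Pt \<and>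
     P $$ (0, 0) = 1 / \<nu> \<and> Pt $$ (0, 0) = 1 / \<nu> \<and>
     (\<forall>j\<le>d. U $$ (0, j) = 1 \<and> U $$ (j, 0) = 1) \<and>
     \<nu> \<cdot>\<^sub>m (P * U * Pt * transpose_mat U) = 1\<^sub>m (d + 1)}"

text \<open>
  A multi-index \<open>(\<lambda>\<^sub>0, \<dots>, \<lambda>\<^sub>d)\<close> is a finitely supported function supported in \<open>{0..d}\<close>, and a
  polynomial is a finitely supported function from multi-indices to coefficients; its ring
  structure is the convolution product of \<open>Poly_Mapping\<close>.
\<close>

type_synonym multi_index = "nat \<Rightarrow>\<^sub>0 nat"
type_synonym cpoly = "multi_index \<Rightarrow>\<^sub>0 complex"

definition multi_indices :: "nat \<Rightarrow> nat \<Rightarrow> multi_index set" where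
  "multi_indices d N = {l. Poly_Mapping.keys l \<subseteq> {0..d} \<and> (\<Sum>i=0..d. Poly_Mapping.lookup l i) = N}"

definition multi_power :: "nat \<Rightarrow> (nat \<Rightarrow> 'a::comm_monoid_mult) \<Rightarrow> multi_index \<Rightarrow> 'a" where
  "multi_power d y l = (\<Prod>i=0..d. y i ^ Poly_Mapping.lookup l i)"

definition multi_fact :: "nat \<Rightarrow> multi_index \<Rightarrow> complex" where
  "multi_fact d l = (\<Prod>i=0..d. fact (Poly_Mapping.lookup l i))"

definition Const :: "complex \<Rightarrow> cpoly" where
  "Const c = Poly_Mapping.single 0 c"

definition Var :: "nat \<Rightarrow> cpoly" where
  "Var i = Poly_Mapping.single (Poly_Mapping.single i 1) 1"

text \<open>The row vector \<open>x R\<close>.\<close>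

definition Var_tilde :: "nat \<Rightarrow> complex mat \<Rightarrow> nat \<Rightarrow> cpoly" where
  "Var_tilde d R j = (\<Sum>i=0..d. Var i * Const (R $$ (i, j)))"

definition hom_polys :: "nat \<Rightarrow> nat \<Rightarrow> cpoly set" where
  "hom_polys d N = {\<Sum>l\<in>multi_indices d N. Const (c l) * multi_power d Var l | c. True}"

text \<open>
  The bilinear extension to \<open>hom_polys d N\<close> of the prescribed values on pairs of monomials
  (see \<open>bform_monomials\<close> and the bilinearity lemmas below), written out in coefficients;
  coefficients in other degrees are ignored.
  The diagonal of the second diagonal matrix is the vector \<open>\<lambda>i. Pt $$ (i, i)\<close>.
\<close>

definition bform ::
  "nat \<Rightarrow> nat \<Rightarrow> complex mat \<Rightarrow> complex \<Rightarrow> cpoly \<Rightarrow> cpoly \<Rightarrow> complex" where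
  "bform d N Pt \<theta> f g =
     (\<Sum>l\<in>multi_indices d N.
        Poly_Mapping.lookup f l * Poly_Mapping.lookup g l *
        (multi_fact d l / multi_power d (\<lambda>i. Pt $$ (i, i)) l * \<theta> ^ N))"

definition exponent_matrices :: "nat \<Rightarrow> nat \<Rightarrow> (nat \<times> nat \<Rightarrow> nat) set" where
  "exponent_matrices d N =
     {a \<in> {1..d} \<times> {1..d} \<rightarrow>\<^sub>E UNIV. (\<Sum>ij\<in>{1..d} \<times> {1..d}. a ij) \<le> N}"

text \<open>\<open>m\<close> and \<open>mt\<close> are vectors indexed by \<open>1, \<dots>, d\<close>; other arguments are irrelevant.\<close>

definition krawtchouk ::
  "nat \<Rightarrow> nat \<Rightarrow> complex mat \<Rightarrow> (nat \<Rightarrow> nat) \<Rightarrow> (nat \<Rightarrow> nat) \<Rightarrow> complex" where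
  "krawtchouk d N U m mt =
     (\<Sum>a\<in>exponent_matrices d N.
        (\<Prod>j=1..d. pochhammer (- of_nat (m j)) (\<Sum>i=1..d. a (i, j))) *
        (\<Prod>i=1..d. pochhammer (- of_nat (mt i)) (\<Sum>j=1..d. a (i, j))) /
        pochhammer (- of_nat N) (\<Sum>i=1..d. \<Sum>j=1..d. a (i, j)) *
        (\<Prod>i=1..d. \<Prod>j=1..d. (1 - U $$ (i, j)) ^ a (i, j) / fact (a (i, j))))"

definition drop_zeroth :: "nat \<Rightarrow> multi_index \<Rightarrow> nat \<Rightarrow> nat" where
  "drop_zeroth d w = restrict (Poly_Mapping.lookup w) {1..d}"

lemma finite_exponent_matrices: "finite (exponent_matrices d N)"
proof (rule finite_subset)
  show "exponent_matrices d N \<subseteq> {1..d} \<times> {1..d} \<rightarrow>\<^sub>E {..N}"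
  proof
    fix a assume a: "a \<in> exponent_matrices d N"
    have "a ij \<le> N" if "ij \<in> {1..d} \<times> {1..d}" for ij
      using a member_le_sum[OF that, of a] unfolding exponent_matrices_def by auto
    with a show "a \<in> {1..d} \<times> {1..d} \<rightarrow>\<^sub>E {..N}"
      unfolding exponent_matrices_def by (auto simp: PiE_iff)
  qed
qed (auto intro!: finite_PiE)

lemma finite_multi_indices: "finite (multi_indices d N)"
proof (rule finite_imageD)
  let ?r = "\<lambda>l. restrict (Poly_Mapping.lookup l) {0..d}"
  show "finite (?r ` multi_indices d N)"
  proof (rule finite_subset)
    show "?r ` multi_indices d N \<subseteq> {0..d} \<rightarrow>\<^sub>E {..N}"
    proof clarify
      fix l assume l: "l \<in> multi_indices d N"
      have "Poly_Mapping.lookup l i \<le> N" if "i \<in> {0..d}" for i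
        using l member_le_sum[OF that, of "Poly_Mapping.lookup l"] unfolding multi_indices_def by auto
      then show "?r l \<in> {0..d} \<rightarrow>\<^sub>E {..N}" by auto
    qed
  qed (auto intro!: finite_PiE)
  show "inj_on ?r (multi_indices d N)"
  proof (rule inj_onI)
    fix l k assume l: "l \<in> multi_indices d N" "k \<in> multi_indices d N" and eq: "?r l = ?r k"
    have "Poly_Mapping.lookup l i = Poly_Mapping.lookup k i" for i
    proof (cases "i \<in> {0..d}")
      case True
      with fun_cong[OF eq, of i] show ?thesis by simp
    next
      case False
      with l have "i \<notin> Poly_Mapping.keys l" "i \<notin> Poly_Mapping.keys k" unfolding multi_indices_def by auto
      then show ?thesis by (simp add: in_keys_iff)
    qed
    then show "l = k" by (intro poly_mapping_eqI)
  qed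
qed

lemma Var_power: "Var i ^ k = Poly_Mapping.single (Poly_Mapping.single i k) 1"
  by (induction k) (auto simp: Var_def mult_single single_add[symmetric] simp flip: single_one)

lemma multi_power_Var:
  assumes "Poly_Mapping.keys l \<subseteq> {0..d}"
  shows "multi_power d Var l = Poly_Mapping.single l 1"
proof -
  have *: "(\<Prod>i\<in>A. Poly_Mapping.single (Poly_Mapping.single i (Poly_Mapping.lookup l i)) (1::complex)) =
      Poly_Mapping.single (\<Sum>i\<in>A. Poly_Mapping.single i (Poly_Mapping.lookup l i)) 1" if "finite A" for A
    using that by induction (auto simp: mult_single simp flip: single_one)
  have "(\<Sum>i=0..d. Poly_Mapping.single i (Poly_Mapping.lookup l i)) = l"
    using assms by (intro poly_mapping_eqI)
      (auto simp: lookup_sum lookup_single when_def in_keys_iff)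
  then show ?thesis by (simp add: multi_power_def Var_power *)
qed

lemma bform_monomials:
  assumes "n \<in> multi_indices d N" "m \<in> multi_indices d N"
  shows "bform d N Pt \<theta> (multi_power d Var n) (multi_power d Var m) =
    (if n = m then multi_fact d n / multi_power d (\<lambda>i. Pt $$ (i, i)) n * \<theta> ^ N else 0)"
proof -
  let ?w = "\<lambda>l. multi_fact d l / multi_power d (\<lambda>i. Pt $$ (i, i)) l * \<theta> ^ N"
  have "multi_power d Var n = Poly_Mapping.single n 1" "multi_power d Var m = Poly_Mapping.single m 1"
    using assms by (auto simp: multi_indices_def multi_power_Var)
  then have "bform d N Pt \<theta> (multi_power d Var n) (multi_power d Var m) =
      (\<Sum>l\<in>multi_indices d N. if n = l then (if n = m then ?w n else 0) else 0)"
    unfolding bform_def by (intro sum.cong refl) (auto simp: lookup_single when_def)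
  then show ?thesis using assms by (simp add: finite_multi_indices)
qed

lemma lookup_Const_mult: "Poly_Mapping.lookup (Const c * f) l = c * Poly_Mapping.lookup f l"
  unfolding Const_def mult_map_scale_conv_mult[symmetric] by (simp add: map.rep_eq when_def)

lemma bform_commute: "bform d N Pt \<theta> f g = bform d N Pt \<theta> g f"
  unfolding bform_def by (simp add: mult_ac)

lemma bform_add_left: "bform d N Pt \<theta> (f + h) g = bform d N Pt \<theta> f g + bform d N Pt \<theta> h g"
  unfolding bform_def by (simp only: lookup_add distrib_right sum.distrib)

lemma bform_scale_left: "bform d N Pt \<theta> (Const c * f) g = c * bform d N Pt \<theta> f g"
  unfolding bform_def by (simp add: lookup_Const_mult sum_distrib_left mult.assoc)

lemma hom_polys_iff: "f \<in> hom_polys d N \<longleftrightarrow> Poly_Mapping.keys f \<subseteq> multi_indices d N"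
proof -
  have mono: "multi_power d Var l = Poly_Mapping.single l 1" if "l \<in> multi_indices d N" for l
    using that by (auto simp: multi_indices_def multi_power_Var)
  have coeff: "Poly_Mapping.lookup (\<Sum>l\<in>multi_indices d N. Const (c l) * multi_power d Var l) k =
      (if k \<in> multi_indices d N then c k else 0)" for c k
    by (simp add: lookup_sum lookup_Const_mult mono lookup_single when_def finite_multi_indices
        if_distrib cong: sum.cong if_cong)
  show ?thesis
  proof
    assume "f \<in> hom_polys d N"
    then show "Poly_Mapping.keys f \<subseteq> multi_indices d N"
      by (auto simp: hom_polys_def in_keys_iff coeff split: if_splits)
  next
    assume "Poly_Mapping.keys f \<subseteq> multi_indices d N"
    then have "f = (\<Sum>l\<in>multi_indices d N. Const (Poly_Mapping.lookup f l) * multi_power d Var l)"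
      by (intro poly_mapping_eqI) (auto simp: coeff in_keys_iff)
    then show "f \<in> hom_polys d N" unfolding hom_polys_def by blast
  qed
qed

lemma hom_polys_mult:
  assumes "f \<in> hom_polys d M" "g \<in> hom_polys d N"
  shows "f * g \<in> hom_polys d (M + N)"
  unfolding hom_polys_iff
proof
  fix k assume "k \<in> Poly_Mapping.keys (f * g)"
  then obtain a b where k: "k = a + b" and ab: "a \<in> Poly_Mapping.keys f" "b \<in> Poly_Mapping.keys g"
    using keys_mult by blast
  then have *: "a \<in> multi_indices d M" "b \<in> multi_indices d N"
    using assms by (auto simp: hom_polys_iff)
  then have "Poly_Mapping.keys (a + b) \<subseteq> {0..d}"
    using keys_add[of a b] unfolding multi_indices_def by blast
  with * k show "k \<in> multi_indices d (M + N)"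
    by (simp add: multi_indices_def lookup_add sum.distrib)
qed

lemma hom_polys_one: "1 \<in> hom_polys d 0"
  by (simp add: hom_polys_iff multi_indices_def)

lemma hom_polys_power: "f \<in> hom_polys d 1 \<Longrightarrow> f ^ k \<in> hom_polys d k"
proof (induction k)
  case (Suc k)
  then show ?case using hom_polys_mult[of f d 1 "f ^ k" k] by simp
qed (simp add: hom_polys_one)

lemma Var_tilde_in_hom_polys: "Var_tilde d R j \<in> hom_polys d 1"
proof -
  have "Poly_Mapping.keys (Var i * Const c) \<subseteq> multi_indices d 1" if "i \<in> {0..d}" for i c
  proof -
    have "Var i * Const c = Poly_Mapping.single (Poly_Mapping.single i 1) c"
      by (simp add: Var_def Const_def mult_single)
    with that show ?thesis
      by (auto simp: multi_indices_def lookup_single when_def)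
  qed
  then show ?thesis
    unfolding hom_polys_iff Var_tilde_def
    using keys_sum[of "\<lambda>i. Var i * Const (R $$ (i, j))" "{0..d}"] by blast
qed

lemma multi_power_Var_tilde_in_hom_polys:
  assumes "l \<in> multi_indices d N"
  shows "multi_power d (Var_tilde d R) l \<in> hom_polys d N"
proof -
  have "(\<Prod>i\<in>A. Var_tilde d R i ^ Poly_Mapping.lookup l i) \<in>
      hom_polys d (\<Sum>i\<in>A. Poly_Mapping.lookup l i)" if "finite A" for A
    using that by induction
      (auto intro!: hom_polys_mult hom_polys_power Var_tilde_in_hom_polys simp: hom_polys_one)
  from this[of "{0..d}"] assms show ?thesis
    by (simp add: multi_power_def multi_indices_def)
qed

end

theory Submission
  imports Defs
begin

text \<open>
  Put \<open>y\<^sub>j = Pt\<^sub>j\<^sub>j x\<^sub>j\<close> and \<open>S = y\<^sub>0 + \<dots> + y\<^sub>d\<close>. Since \<open>\<theta> \<theta>t = \<nu>\<close>, the right-hand side is \<open>n! / N!\<close>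
  times the coefficient of \<open>y\<^sup>n\<close> in the product over \<open>i\<close> of the \<open>nt\<^sub>i\<close>-th powers of
  \<open>\<Sum>\<^sub>j U\<^sub>i\<^sub>j y\<^sub>j = S - \<Sum>\<^sub>j (1 - U\<^sub>i\<^sub>j) y\<^sub>j\<close>. Here the terms with \<open>j = 0\<close> in the last sum vanish, as does
  the whole sum for \<open>i = 0\<close>. Expanding each row \<open>i \<ge> 1\<close> by the multinomial theorem gives a sum
  over matrices \<open>a\<close>, in which \<open>S\<close> occurs to the power \<open>N - |a|\<close>; the multinomial coefficients of
  this power of \<open>S\<close>, together with \<open>n! / N!\<close>, are the remaining Pochhammer symbols.
\<close>

section \<open>Constant polynomials and sums over function spaces\<close>

lemma Const_1: "Const 1 = 1"
  by (simp add: Const_def)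

lemma Const_mult: "Const (a * b) = Const a * Const b"
  by (simp add: Const_def mult_single)

lemma Const_diff: "Const (a - b) = Const a - Const b"
  by (simp add: Const_def single_diff)

lemma Const_prod: "Const (\<Prod>i\<in>A. f i) = (\<Prod>i\<in>A. Const (f i))"
  by (induction A rule: infinite_finite_induct) (simp_all add: Const_mult Const_1)

lemma Const_power: "Const (a ^ k) = Const a ^ k"
  by (induction k) (simp_all add: Const_mult Const_1)

text \<open>Peeling off one index is the induction step for the multinomial expansion of a
  row.\<close>

lemma sum_PiE_insert:
  assumes "finite J" "x \<notin> J"
  shows "(\<Sum>a\<in>PiE (insert x J) B. f a) = (\<Sum>g\<in>PiE J B. \<Sum>k\<in>B x. f (g(x := k)))"
proof -
  have "(\<Sum>a\<in>PiE (insert x J) B. f a) = (\<Sum>(k, g)\<in>B x \<times> PiE J B. f (g(x := k)))"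
    unfolding PiE_insert_eq using assms(2)
    by (subst sum.reindex[OF inj_combinator]) (simp_all add: case_prod_unfold)
  also have "\<dots> = (\<Sum>g\<in>PiE J B. \<Sum>k\<in>B x. f (g(x := k)))"
    by (subst sum.cartesian_product[symmetric]) (rule sum.swap)
  finally show ?thesis .
qed

section \<open>Multinomial expansion with Pochhammer symbols\<close>

text \<open>The quotient of the two factorials is the rising factorial from \<open>r + 1\<close>;
  reading its \<open>k\<close> factors downwards and negating each gives the Pochhammer symbol of
  \<open>- (r + k)\<close>.\<close>

lemma fact_eq_pochhammer_mult_fact:
  "(fact (r + k) :: complex) = (-1) ^ k * pochhammer (- of_nat (r + k)) k * fact r"
proof -
  have "fact (r + k) = (fact r :: complex) * pochhammer (of_nat r + 1) k"
    by (simp only: pochhammer_fact pochhammer_product'[of 1 r k]) (simp add: add.commute)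
  moreover have "of_nat (r + k) - of_nat k + 1 = (of_nat r + 1 :: complex)"
    by simp
  ultimately show ?thesis
    by (simp only: pochhammer_minus) (simp add: mult_ac flip: power_mult_distrib)
qed

text \<open>The signed binomial coefficient is a Pochhammer symbol over \<open>fact k\<close>. As
  this vanishes for \<open>k > m\<close>, the sum may run up to any common bound \<open>M\<close>,
  so that all rows can later share one index set.\<close>

lemma power_diff_pochhammer:
  fixes X W :: cpoly
  assumes "m \<le> M"
  shows "(X - W) ^ m =
    (\<Sum>k\<le>M. Const (pochhammer (- of_nat m) k / fact k) * (X ^ (m - k) * W ^ k))"
proof -
  have coeff: "of_nat (m choose k) * (- 1) ^ k = Const (pochhammer (- of_nat m) k / fact k)"
    if "k \<le> m" for k
  proof -
    have "of_nat (m choose k) * (- 1) ^ k = (pochhammer (- of_nat m) k / fact k :: complex)"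
      by (simp add: binomial_gbinomial gbinomial_pochhammer field_simps flip: power_add)
    moreover have "Const (of_nat (m choose k) * (- 1) ^ k) = of_nat (m choose k) * (- 1) ^ k"
    proof -
      have "Const (of_nat (m choose k)) = of_nat (m choose k)"
        by (simp add: Const_def)
      moreover have "Const (-1) = - 1"
        by (simp add: Const_def single_uminus)
      ultimately show ?thesis by (simp add: Const_mult Const_power)
    qed
    ultimately show ?thesis by metis
  qed
  have "(X - W) ^ m = (\<Sum>k\<le>m. of_nat (m choose k) * (- W) ^ k * X ^ (m - k))"
    using binomial_ring[of "- W" X m] by simp
  also have "\<dots> = (\<Sum>k\<le>m. Const (pochhammer (- of_nat m) k / fact k) * (X ^ (m - k) * W ^ k))"
    by (intro sum.cong refl) (simp add: power_minus[of W] mult_ac flip: coeff)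
  also have "\<dots> = (\<Sum>k\<le>M. Const (pochhammer (- of_nat m) k / fact k) * (X ^ (m - k) * W ^ k))"
    using assms
    by (intro sum.mono_neutral_left) (auto simp: pochhammer_of_nat_eq_0_lemma Const_def)
  finally show ?thesis .
qed

text \<open>Summing over a box rather than a simplex is harmless: the Pochhammer symbol vanishes
  as soon as the exponents add up to more than \<open>m\<close>.\<close>

lemma power_diff_sum_pochhammer:
  fixes X :: cpoly and W :: "'b \<Rightarrow> cpoly"
  assumes "finite J" "m \<le> M"
  shows "(X - (\<Sum>j\<in>J. W j)) ^ m =
    (\<Sum>a\<in>J \<rightarrow>\<^sub>E {..M}. Const (pochhammer (- of_nat m) (\<Sum>j\<in>J. a j) / (\<Prod>j\<in>J. fact (a j))) *
       (X ^ (m - (\<Sum>j\<in>J. a j)) * (\<Prod>j\<in>J. W j ^ a j)))"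
  using assms(1)
proof (induction J arbitrary: X)
  case empty
  then show ?case by (simp add: Const_1)
next
  case (insert x J)
  let ?s = "\<lambda>a. \<Sum>j\<in>J. a j"
  \<comment> \<open>Absorbing \<open>W x\<close> into \<open>X\<close>, which is arbitrary in the
    induction, lets the hypothesis expand the other summands first; the powers of
    \<open>X - W x\<close> left over are binomial.\<close>
  have "(X - (\<Sum>j\<in>insert x J. W j)) ^ m = ((X - W x) - (\<Sum>j\<in>J. W j)) ^ m"
    using insert.hyps by (simp add: algebra_simps)
  also have "\<dots> = (\<Sum>a\<in>J \<rightarrow>\<^sub>E {..M}. Const (pochhammer (- of_nat m) (?s a) / (\<Prod>j\<in>J. fact (a j))) *
       ((X - W x) ^ (m - ?s a) * (\<Prod>j\<in>J. W j ^ a j)))"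
    by (rule insert.IH)
  also have "\<dots> = (\<Sum>a\<in>J \<rightarrow>\<^sub>E {..M}. \<Sum>k\<le>M.
      Const (pochhammer (- of_nat m) (?s a + k) / ((\<Prod>j\<in>J. fact (a j)) * fact k)) *
       (X ^ (m - (?s a + k)) * ((\<Prod>j\<in>J. W j ^ a j) * W x ^ k)))"
  proof (intro sum.cong refl)
    fix a assume "a \<in> J \<rightarrow>\<^sub>E {..M}"
    show "Const (pochhammer (- of_nat m) (?s a) / (\<Prod>j\<in>J. fact (a j))) *
       ((X - W x) ^ (m - ?s a) * (\<Prod>j\<in>J. W j ^ a j)) =
      (\<Sum>k\<le>M. Const (pochhammer (- of_nat m) (?s a + k) / ((\<Prod>j\<in>J. fact (a j)) * fact k)) *
       (X ^ (m - (?s a + k)) * ((\<Prod>j\<in>J. W j ^ a j) * W x ^ k)))"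
    \<comment> \<open>The Pochhammer symbol of \<open>- m\<close> at \<open>?s a + k\<close> factors
      through that of \<open>- (m - ?s a)\<close> at \<open>k\<close> when the subtraction is exact.
      Otherwise the symbols on both sides vanish.\<close>
    proof (cases "?s a \<le> m")
      case True
      have split: "Const (pochhammer (- of_nat m) (?s a + k) / ((\<Prod>j\<in>J. fact (a j)) * fact k)) =
          Const (pochhammer (- of_nat m) (?s a) / (\<Prod>j\<in>J. fact (a j))) *
          Const (pochhammer (- of_nat (m - ?s a)) k / fact k)" for k
        using True
        by (simp add: pochhammer_product' of_nat_diff Const_mult[symmetric] del: of_nat_sum)
      have "(X - W x) ^ (m - ?s a) =
        (\<Sum>k\<le>M. Const (pochhammer (- of_nat (m - ?s a)) k / fact k) * (X ^ (m - ?s a - k) * W x ^ k))"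
        using assms(2) by (intro power_diff_pochhammer) simp
      then show ?thesis
        by (simp only: split) (simp only: sum_distrib_left sum_distrib_right diff_diff_left mult_ac)
    next
      case False
      then show ?thesis
        by (simp add: pochhammer_of_nat_eq_0_lemma Const_def)
    qed
  qed
  also have "\<dots> = (\<Sum>a\<in>insert x J \<rightarrow>\<^sub>E {..M}.
      Const (pochhammer (- of_nat m) (\<Sum>j\<in>insert x J. a j) / (\<Prod>j\<in>insert x J. fact (a j))) *
       (X ^ (m - (\<Sum>j\<in>insert x J. a j)) * (\<Prod>j\<in>insert x J. W j ^ a j)))"
  proof -
    have ne: "j \<noteq> x" if "j \<in> J" for j
      using that insert.hyps by blast
    have upd: "(\<Sum>j\<in>insert x J. (a(x := k)) j) = ?s a + k"
      "(\<Prod>j\<in>insert x J. fact ((a(x := k)) j)) = (\<Prod>j\<in>J. fact (a j)) * (fact k :: complex)"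
      "(\<Prod>j\<in>insert x J. W j ^ (a(x := k)) j) = (\<Prod>j\<in>J. W j ^ a j) * W x ^ k" for a k
      using insert.hyps ne by (simp_all add: mult_ac cong: sum.cong prod.cong)
    show ?thesis
      by (subst sum_PiE_insert[OF insert.hyps]) (simp only: upd)
  qed
  finally show ?case .
qed

section \<open>Coefficients of powers of a linear form times a monomial\<close>

text \<open>A monomial factor shifts exponents injectively. Writing the target as
  \<open>c + l\<close> avoids truncated subtraction of multi-indices.\<close>

lemma lookup_monomial_mult:
  "Poly_Mapping.lookup (Poly_Mapping.single c (1::complex) * f) (c + l) = Poly_Mapping.lookup f l"
  for c :: multi_index
proof -
  have f: "f = (\<Sum>k\<in>Poly_Mapping.keys f. Poly_Mapping.single k (Poly_Mapping.lookup f k))"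
    by (intro poly_mapping_eqI) (simp add: lookup_sum lookup_single when_def in_keys_iff)
  have "Poly_Mapping.single c 1 * f =
      (\<Sum>k\<in>Poly_Mapping.keys f. Poly_Mapping.single (c + k) (Poly_Mapping.lookup f k))"
    by (subst f) (simp add: sum_distrib_left mult_single)
  then show ?thesis
    by (simp add: lookup_sum lookup_single when_def in_keys_iff)
qed

lemma lookup_monomial_mult_eq_0:
  fixes c :: multi_index
  assumes "Poly_Mapping.lookup l i < Poly_Mapping.lookup c i"
  shows "Poly_Mapping.lookup (Poly_Mapping.single c (1::complex) * f) l = 0"
proof (rule ccontr)
  assume "Poly_Mapping.lookup (Poly_Mapping.single c (1::complex) * f) l \<noteq> 0"
  then have "l \<in> Poly_Mapping.keys (Poly_Mapping.single c (1::complex) * f)"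
    by (simp add: in_keys_iff)
  then obtain k where "l = c + k"
    using keys_mult[of "Poly_Mapping.single c (1::complex)" f] by auto
  then show False using assms by (simp add: lookup_add)
qed

lemma multi_power_add: "multi_power d y (k + l) = multi_power d y k * multi_power d y l"
  by (simp add: multi_power_def lookup_add power_add prod.distrib)

lemma multi_power_single:
  assumes "i \<le> d"
  shows "multi_power d y (Poly_Mapping.single i k) = y i ^ k"
proof -
  have "multi_power d y (Poly_Mapping.single i k) = (\<Prod>j=0..d. if j = i then y i ^ k else 1)"
    unfolding multi_power_def by (intro prod.cong) (auto simp: lookup_single when_def)
  then show ?thesis using assms by simp
qed

lemma multi_fact_nonzero: "multi_fact d l \<noteq> 0"
  by (simp add: multi_fact_def)

lemma multi_fact_add_single:
  assumes "i \<le> d"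
  shows "multi_fact d (Poly_Mapping.single i 1 + l) =
    of_nat (Suc (Poly_Mapping.lookup l i)) * multi_fact d l"
proof -
  have "multi_fact d (Poly_Mapping.single i 1 + l) =
      (\<Prod>j=0..d. (if j = i then of_nat (Suc (Poly_Mapping.lookup l i)) else 1) * fact (Poly_Mapping.lookup l j))"
    unfolding multi_fact_def by (intro prod.cong) (auto simp: lookup_single lookup_add when_def)
  then show ?thesis using assms by (simp add: prod.distrib multi_fact_def)
qed

text \<open>This is the multinomial theorem. Splitting off one factor of the power, its summand
  \<open>i\<close> contributes the share \<open>Poly_Mapping.lookup l i / Suc k\<close> of the
  coefficient, and the shares add up to one because \<open>l\<close> has total degree
  \<open>Suc k\<close>.\<close>

lemma lookup_power_sum_Var:
  assumes "l \<in> multi_indices d k"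
  shows "Poly_Mapping.lookup ((\<Sum>i=0..d. Const (q i) * Var i) ^ k) l =
    fact k / multi_fact d l * multi_power d q l"
  using assms
proof (induction k arbitrary: l)
  case 0
  then have "Poly_Mapping.lookup l i = 0" for i
    by (cases "i \<le> d") (auto simp: multi_indices_def in_keys_iff)
  then have "l = 0" by (intro poly_mapping_eqI) simp
  then show ?case by (simp add: multi_fact_def multi_power_def)
next
  case (Suc k)
  let ?S = "\<Sum>i=0..d. Const (q i) * Var i"
  have l: "Poly_Mapping.keys l \<subseteq> {0..d}" "(\<Sum>i=0..d. Poly_Mapping.lookup l i) = Suc k"
    using Suc.prems by (auto simp: multi_indices_def)
  have "Poly_Mapping.lookup (?S ^ Suc k) l =
      (\<Sum>i=0..d. q i * Poly_Mapping.lookup (Var i * ?S ^ k) l)"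
    by (simp add: sum_distrib_right lookup_sum mult.assoc lookup_Const_mult)
  also have "\<dots> = (\<Sum>i=0..d. of_nat (Poly_Mapping.lookup l i) *
      (fact k / multi_fact d l * multi_power d q l))"
  proof (intro sum.cong refl)
    fix i assume i: "i \<in> {0..d}"
    show "q i * Poly_Mapping.lookup (Var i * ?S ^ k) l =
      of_nat (Poly_Mapping.lookup l i) * (fact k / multi_fact d l * multi_power d q l)"
    proof (cases "Poly_Mapping.lookup l i = 0")
      case True
      then show ?thesis
        using lookup_monomial_mult_eq_0[of l i "Poly_Mapping.single i 1"] by (simp add: Var_def)
    next
      case False
      \<comment> \<open>The exponent of \<open>i\<close> is positive here, so the truncated
        difference is exact.\<close>
      define l' where "l' = l - Poly_Mapping.single i 1"
      have ll': "l = Poly_Mapping.single i 1 + l'"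
        using False
        by (intro poly_mapping_eqI) (auto simp: l'_def lookup_add lookup_minus lookup_single when_def)
      have "(\<Sum>j=0..d. Poly_Mapping.lookup l j) =
          (\<Sum>j=0..d. if j = i then 1 else 0) + (\<Sum>j=0..d. Poly_Mapping.lookup l' j)"
        unfolding ll' sum.distrib[symmetric]
        by (intro sum.cong) (auto simp: lookup_add lookup_single when_def)
      moreover have "Poly_Mapping.keys l' \<subseteq> Poly_Mapping.keys l"
        by (auto simp: ll' in_keys_iff lookup_add)
      ultimately have "l' \<in> multi_indices d k"
        using l i by (auto simp: multi_indices_def)
      moreover have "Poly_Mapping.lookup (Var i * ?S ^ k) l = Poly_Mapping.lookup (?S ^ k) l'"
        unfolding Var_def ll' by (rule lookup_monomial_mult)
      ultimately have "Poly_Mapping.lookup (Var i * ?S ^ k) l = fact k / multi_fact d l' * multi_power d q l'"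
        by (simp only: Suc.IH)
      moreover have "multi_power d q l = q i * multi_power d q l'"
        using i by (simp add: ll' multi_power_add multi_power_single)
      moreover have "multi_fact d l = of_nat (Poly_Mapping.lookup l i) * multi_fact d l'"
        using i multi_fact_add_single[of i d l'] by (simp add: ll' lookup_add)
      ultimately show ?thesis
        using False by (simp add: multi_fact_nonzero)
    qed
  qed
  also have "\<dots> = of_nat (Suc k) * (fact k / multi_fact d l * multi_power d q l)"
    by (simp only: sum_distrib_right[symmetric] of_nat_sum[symmetric] l)
  finally show ?case by (simp add: field_simps)
qed

text \<open>Up to powers of \<open>q\<close> the coefficient is K! / (n - c)!. Multiplied by n! / N!
  it becomes a quotient of falling factorials, that is, of Pochhammer symbols at negative integers.
  Multiplying out the denominators keeps the identity free of division.\<close>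

lemma lookup_power_sum_Var_mult_monomial:
  assumes n: "n \<in> multi_indices d N"
    and N: "K + (\<Sum>j=1..d. c j) = N"
  shows "multi_fact d n *
      Poly_Mapping.lookup ((\<Sum>i=0..d. Const (q i) * Var i) ^ K * (\<Prod>j=1..d. (Const (q j) * Var j) ^ c j)) n *
      pochhammer (- of_nat N) (\<Sum>j=1..d. c j) =
    fact N * multi_power d q n * (\<Prod>j=1..d. pochhammer (- of_nat (Poly_Mapping.lookup n j)) (c j))"
proof -
  let ?S = "\<Sum>i=0..d. Const (q i) * Var i"
  \<comment> \<open>\<open>C\<close> extends \<open>c\<close> by the exponent 0 at index 0, turning
    the product over \<open>{1..d}\<close> into a monomial in all variables.\<close>
  define C where "C = (\<Sum>j=1..d. Poly_Mapping.single j (c j))"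
  have lookup_C: "Poly_Mapping.lookup C i = (if i \<in> {1..d} then c i else 0)" for i
    by (simp add: C_def lookup_sum lookup_single when_def)
  have keys_C: "Poly_Mapping.keys C \<subseteq> {0..d}"
    by (auto simp: in_keys_iff lookup_C split: if_splits)
  have zeroth: "(\<Prod>j=0..d. f j) = (f 0 :: 'a::comm_monoid_mult) * (\<Prod>j=1..d. f j)" for f
    by (simp add: prod.atLeast_Suc_atMost)
  have "(\<Prod>j=1..d. (Const (q j) * Var j) ^ c j) = multi_power d (\<lambda>j. Const (q j) * Var j) C"
    by (simp add: multi_power_def zeroth lookup_C)
  also have "\<dots> = Const (multi_power d q C) * multi_power d Var C"
    by (simp add: multi_power_def power_mult_distrib prod.distrib Const_prod Const_power)
  also have "\<dots> = Const (multi_power d q C) * Poly_Mapping.single C 1"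
    by (simp add: multi_power_Var keys_C)
  finally have lookup_eq:
    "Poly_Mapping.lookup (?S ^ K * (\<Prod>j=1..d. (Const (q j) * Var j) ^ c j)) n =
      multi_power d q C * Poly_Mapping.lookup (Poly_Mapping.single C 1 * ?S ^ K) n"
    by (simp add: mult_ac flip: lookup_Const_mult)
  show ?thesis
  \<comment> \<open>If some \<open>c j\<close> exceeds the exponent of \<open>j\<close> in
    \<open>n\<close>, the monomial of \<open>C\<close> does not divide that of \<open>n\<close>, and
    the Pochhammer symbol for \<open>j\<close> vanishes as well. Otherwise \<open>n = C + l\<close>
    with a genuine multi-index \<open>l\<close>.\<close>
  proof (cases "\<exists>j\<in>{1..d}. Poly_Mapping.lookup n j < c j")
    case True
    then obtain j where j: "j \<in> {1..d}" "Poly_Mapping.lookup n j < c j" by blast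
    then have "pochhammer (- of_nat (Poly_Mapping.lookup n j) :: complex) (c j) = 0"
      by (simp add: pochhammer_of_nat_eq_0_lemma)
    with j(1) have "(\<Prod>j=1..d. pochhammer (- of_nat (Poly_Mapping.lookup n j) :: complex) (c j)) = 0"
      by (intro prod_zero) auto
    moreover have "Poly_Mapping.lookup (Poly_Mapping.single C 1 * ?S ^ K) n = 0"
      by (rule lookup_monomial_mult_eq_0[of _ j]) (use j in \<open>simp add: lookup_C\<close>)
    ultimately show ?thesis
      by (simp only: lookup_eq mult_zero_left mult_zero_right)
  next
    case False
    define l where "l = n - C"
    have nCl: "n = C + l"
      using False
      by (intro poly_mapping_eqI) (auto simp: l_def lookup_add lookup_minus lookup_C not_less)
    have "(\<Sum>j=0..d. Poly_Mapping.lookup C j) = (\<Sum>j=1..d. c j)"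
      by (simp add: sum.atLeast_Suc_atMost lookup_C)
    moreover have "Poly_Mapping.keys l \<subseteq> Poly_Mapping.keys n"
      by (auto simp: nCl in_keys_iff lookup_add)
    ultimately have l: "l \<in> multi_indices d K"
      using n N by (auto simp: multi_indices_def nCl lookup_add sum.distrib)
    have nj: "fact (Poly_Mapping.lookup n j) =
        (-1) ^ c j * pochhammer (- of_nat (Poly_Mapping.lookup n j)) (c j) * (fact (Poly_Mapping.lookup l j) :: complex)"
      if "j \<in> {1..d}" for j
      using that fact_eq_pochhammer_mult_fact[of "Poly_Mapping.lookup l j" "c j"]
      by (simp add: nCl lookup_add lookup_C add.commute)
    have n0: "Poly_Mapping.lookup n 0 = Poly_Mapping.lookup l 0"
      by (simp add: nCl lookup_add lookup_C)
    have "(\<Prod>j=1..d. fact (Poly_Mapping.lookup n j)) =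
        (\<Prod>j=1..d. (-1) ^ c j * pochhammer (- of_nat (Poly_Mapping.lookup n j)) (c j) *
          (fact (Poly_Mapping.lookup l j) :: complex))"
      by (intro prod.cong refl nj)
    \<comment> \<open>The same sign occurs here and in the formula for \<open>fact N\<close> below,
      so it cancels in the claim.\<close>
    then have "multi_fact d n = (-1) ^ (\<Sum>j=1..d. c j) *
        (\<Prod>j=1..d. pochhammer (- of_nat (Poly_Mapping.lookup n j)) (c j)) * multi_fact d l"
      unfolding multi_fact_def zeroth n0 by (simp add: prod.distrib power_sum)
    moreover have "fact N = (-1) ^ (\<Sum>j=1..d. c j) * pochhammer (- of_nat N) (\<Sum>j=1..d. c j) * (fact K :: complex)"
      using fact_eq_pochhammer_mult_fact[of K "\<Sum>j=1..d. c j"] by (simp only: N)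
    moreover have "Poly_Mapping.lookup (Poly_Mapping.single C 1 * ?S ^ K) n =
        fact K / multi_fact d l * multi_power d q l"
      unfolding nCl lookup_monomial_mult using l by (rule lookup_power_sum_Var)
    moreover have "multi_power d q n = multi_power d q C * multi_power d q l"
      by (simp add: nCl multi_power_add)
    ultimately show ?thesis
      unfolding lookup_eq by (simp add: multi_fact_nonzero)
  qed
qed

section \<open>The Krawtchouk sum as a coefficient of a product of linear forms\<close>

lemma exponent_matrices_subset: "exponent_matrices d N \<subseteq> {1..d} \<times> {1..d} \<rightarrow>\<^sub>E {..N}"
proof
  fix a assume a: "a \<in> exponent_matrices d N"
  have "a ij \<le> N" if "ij \<in> {1..d} \<times> {1..d}" for ij
    using a member_le_sum[OF that, of a] unfolding exponent_matrices_def by auto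
  with a show "a \<in> {1..d} \<times> {1..d} \<rightarrow>\<^sub>E {..N}"
    unfolding exponent_matrices_def by (auto simp: PiE_iff)
qed

text \<open>The terms outside \<open>exponent_matrices\<close> vanish because the Pochhammer symbol in their
  denominator does, division by zero being zero.\<close>

lemma krawtchouk_eq_sum_rows:
  "krawtchouk d N U m mt =
    (\<Sum>g\<in>{1..d} \<rightarrow>\<^sub>E ({1..d} \<rightarrow>\<^sub>E {..N}).
      (\<Prod>j=1..d. pochhammer (- of_nat (m j)) (\<Sum>i=1..d. g i j)) *
      (\<Prod>i=1..d. pochhammer (- of_nat (mt i)) (\<Sum>j=1..d. g i j)) /
      pochhammer (- of_nat N) (\<Sum>i=1..d. \<Sum>j=1..d. g i j) *
      (\<Prod>i=1..d. \<Prod>j=1..d. (1 - U $$ (i, j)) ^ g i j / fact (g i j)))"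
proof -
  let ?T = "\<lambda>a. (\<Prod>j=1..d. pochhammer (- of_nat (m j)) (\<Sum>i=1..d. a (i, j))) *
        (\<Prod>i=1..d. pochhammer (- of_nat (mt i)) (\<Sum>j=1..d. a (i, j))) /
        pochhammer (- of_nat N) (\<Sum>i=1..d. \<Sum>j=1..d. a (i, j)) *
        (\<Prod>i=1..d. \<Prod>j=1..d. (1 - U $$ (i, j)) ^ a (i, j) / fact (a (i, j)))"
  have "krawtchouk d N U m mt = (\<Sum>a\<in>{1..d} \<times> {1..d} \<rightarrow>\<^sub>E {..N}. ?T a)"
    unfolding krawtchouk_def
  proof (intro sum.mono_neutral_left ballI)
    fix a assume "a \<in> ({1..d} \<times> {1..d} \<rightarrow>\<^sub>E {..N}) - exponent_matrices d N"
    then have "N < (\<Sum>i=1..d. \<Sum>j=1..d. a (i, j))"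
      by (auto simp: exponent_matrices_def sum.cartesian_product PiE_iff)
    then show "?T a = 0"
      by (simp add: pochhammer_of_nat_eq_0_lemma)
  qed (rule finite_PiE exponent_matrices_subset | simp)+
  \<comment> \<open>Currying turns a matrix into a family of rows, the index set produced by
    multiplying out a product of row sums. The restrictions keep both witnesses extensional.\<close>
  also have "\<dots> = (\<Sum>g\<in>{1..d} \<rightarrow>\<^sub>E ({1..d} \<rightarrow>\<^sub>E {..N}). ?T (\<lambda>(i, j). g i j))"
    by (rule sum.reindex_bij_witness[of _
          "\<lambda>g. \<lambda>(i, j)\<in>{1..d} \<times> {1..d}. g i j"
          "\<lambda>a. \<lambda>i\<in>{1..d}. \<lambda>j\<in>{1..d}. a (i, j)"])
      (auto simp: PiE_iff extensional_def restrict_def fun_eq_iff)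
  finally show ?thesis by simp
qed

text \<open>This is the generating function of the Krawtchouk polynomials. Both sides are sums over
  the same families of rows and agree term by term.\<close>

lemma krawtchouk_eq_coefficient:
  assumes U: "\<And>j. j \<le> d \<Longrightarrow> U $$ (0, j) = 1" "\<And>i. i \<le> d \<Longrightarrow> U $$ (i, 0) = 1"
    and n: "n \<in> multi_indices d N" and nt: "nt \<in> multi_indices d N"
  shows "fact N * multi_power d q n * krawtchouk d N U (drop_zeroth d n) (drop_zeroth d nt) =
    multi_fact d n * Poly_Mapping.lookup
      (multi_power d (\<lambda>i. \<Sum>j=0..d. Const (U $$ (i, j)) * (Const (q j) * Var j)) nt) n"
proof -
  define y where "y j = Const (q j) * Var j" for j
  define S where "S = (\<Sum>j=0..d. y j)"
  define \<omega> where "\<omega> i j = 1 - U $$ (i, j)" for i j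
  let ?n = "Poly_Mapping.lookup n" and ?nt = "Poly_Mapping.lookup nt"
  let ?B = "{1..d} \<rightarrow>\<^sub>E {..N}"
  define c :: "nat \<Rightarrow> (nat \<Rightarrow> nat) \<Rightarrow> complex" where "c i b = pochhammer (- of_nat (?nt i)) (\<Sum>j=1..d. b j) / (\<Prod>j=1..d. fact (b j))"
    for i b
  \<comment> \<open>\<open>F i b\<close> is the term for exponents \<open>b\<close> in the expansion
    of row \<open>i\<close>, and \<open>c i b\<close> its scalar factor without the powers of
    \<open>\<omega>\<close>.\<close>
  define F where "F i b = Const (c i b) *
      (S ^ (?nt i - (\<Sum>j=1..d. b j)) * (\<Prod>j=1..d. (Const (\<omega> i j) * y j) ^ b j))" for i b
  have sum_nt: "?nt 0 + (\<Sum>i=1..d. ?nt i) = N"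
    using nt by (simp add: multi_indices_def sum.atLeast_Suc_atMost)
  have nt_le: "?nt i \<le> N" if "i \<in> {1..d}" for i
    using sum_nt member_le_sum[OF that, of ?nt] by simp
  have row: "(\<Sum>j=0..d. Const (U $$ (i, j)) * y j) = S - (\<Sum>j=1..d. Const (\<omega> i j) * y j)"
    if "i \<le> d" for i
  proof -
    have "(\<Sum>j=0..d. Const (U $$ (i, j)) * y j) = S - (\<Sum>j=0..d. Const (\<omega> i j) * y j)"
      by (simp add: S_def \<omega>_def Const_diff Const_1 left_diff_distrib sum_subtractf)
    also have "(\<Sum>j=0..d. Const (\<omega> i j) * y j) = (\<Sum>j=1..d. Const (\<omega> i j) * y j)"
      using that by (simp add: sum.atLeast_Suc_atMost \<omega>_def U) (simp add: Const_def)
    finally show ?thesis .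
  qed
  have "multi_power d (\<lambda>i. \<Sum>j=0..d. Const (U $$ (i, j)) * y j) nt =
      S ^ ?nt 0 * (\<Prod>i=1..d. (S - (\<Sum>j=1..d. Const (\<omega> i j) * y j)) ^ ?nt i)"
  proof -
    have "(\<Sum>j=0..d. Const (U $$ (0, j)) * y j) = S"
      by (simp add: S_def U Const_1)
    then show ?thesis
      by (simp add: multi_power_def prod.atLeast_Suc_atMost row)
  qed
  also have "(\<Prod>i=1..d. (S - (\<Sum>j=1..d. Const (\<omega> i j) * y j)) ^ ?nt i) = (\<Prod>i=1..d. \<Sum>b\<in>?B. F i b)"
    unfolding F_def c_def using nt_le by (intro prod.cong refl power_diff_sum_pochhammer) auto
  also have "\<dots> = (\<Sum>g\<in>{1..d} \<rightarrow>\<^sub>E ?B. \<Prod>i=1..d. F i (g i))"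
    by (intro prod_sum_PiE) (auto intro: finite_PiE)
  finally have expand: "multi_power d (\<lambda>i. \<Sum>j=0..d. Const (U $$ (i, j)) * y j) nt =
      (\<Sum>g\<in>{1..d} \<rightarrow>\<^sub>E ?B. S ^ ?nt 0 * (\<Prod>i=1..d. F i (g i)))"
    by (simp add: sum_distrib_left)
  have term_eq: "fact N * multi_power d q n *
      ((\<Prod>j=1..d. pochhammer (- of_nat (?n j)) (\<Sum>i=1..d. g i j)) *
      (\<Prod>i=1..d. pochhammer (- of_nat (?nt i)) (\<Sum>j=1..d. g i j)) /
      pochhammer (- of_nat N) (\<Sum>i=1..d. \<Sum>j=1..d. g i j) *
      (\<Prod>i=1..d. \<Prod>j=1..d. \<omega> i j ^ g i j / fact (g i j))) =
    multi_fact d n * Poly_Mapping.lookup (S ^ ?nt 0 * (\<Prod>i=1..d. F i (g i))) n" for g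
  \<comment> \<open>A row sum exceeding the exponent in \<open>nt\<close> makes a Pochhammer symbol
    on either side vanish. Otherwise all differences in the exponents of \<open>S\<close> are exact,
    and they add up to \<open>K = N - s\<close>.\<close>
  proof (cases "\<exists>i\<in>{1..d}. ?nt i < (\<Sum>j=1..d. g i j)")
    case True
    then obtain i where i: "i \<in> {1..d}" "?nt i < (\<Sum>j=1..d. g i j)" by blast
    then have zero: "pochhammer (- of_nat (?nt i) :: complex) (\<Sum>j=1..d. g i j) = 0"
      by (intro pochhammer_of_nat_eq_0_lemma)
    then have "(\<Prod>i=1..d. pochhammer (- of_nat (?nt i) :: complex) (\<Sum>j=1..d. g i j)) = 0"
      using i(1) by (intro prod_zero) auto
    moreover have "F i (g i) = 0"
      unfolding F_def c_def zero by (simp add: Const_def)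
    then have "(\<Prod>i=1..d. F i (g i)) = 0"
      using i(1) by (intro prod_zero) auto
    ultimately show ?thesis
      by (simp only: mult_zero_left mult_zero_right div_0 lookup_zero)
  next
    case False
    define s where "s = (\<Sum>j=1..d. \<Sum>i=1..d. g i j)"
    define K where "K = ?nt 0 + (\<Sum>i=1..d. ?nt i - (\<Sum>j=1..d. g i j))"
    have s: "(\<Sum>i=1..d. \<Sum>j=1..d. g i j) = s"
      unfolding s_def by (rule sum.swap)
    have "(\<Sum>i=1..d. ?nt i - (\<Sum>j=1..d. g i j)) + (\<Sum>i=1..d. \<Sum>j=1..d. g i j) = (\<Sum>i=1..d. ?nt i)"
      unfolding sum.distrib[symmetric] using False by (intro sum.cong refl) (auto simp: not_less)
    then have K: "K + s = N"
      using sum_nt unfolding K_def s by linarith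
    have "(\<Prod>i=1..d. F i (g i)) = Const (\<Prod>i=1..d. c i (g i) * (\<Prod>j=1..d. \<omega> i j ^ g i j)) *
        (S ^ (\<Sum>i=1..d. ?nt i - (\<Sum>j=1..d. g i j)) * (\<Prod>i=1..d. \<Prod>j=1..d. y j ^ g i j))"
      by (simp add: F_def prod.distrib power_mult_distrib Const_mult Const_prod Const_power
          power_sum mult_ac)
    also have "(\<Prod>i=1..d. \<Prod>j=1..d. y j ^ g i j) = (\<Prod>j=1..d. y j ^ (\<Sum>i=1..d. g i j))"
      by (subst prod.swap) (simp add: power_sum)
    finally have "S ^ ?nt 0 * (\<Prod>i=1..d. F i (g i)) =
        Const (\<Prod>i=1..d. c i (g i) * (\<Prod>j=1..d. \<omega> i j ^ g i j)) *
        (S ^ K * (\<Prod>j=1..d. y j ^ (\<Sum>i=1..d. g i j)))"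
      by (simp add: K_def power_add mult_ac)
    then have "Poly_Mapping.lookup (S ^ ?nt 0 * (\<Prod>i=1..d. F i (g i))) n =
      (\<Prod>i=1..d. c i (g i) * (\<Prod>j=1..d. \<omega> i j ^ g i j)) *
      Poly_Mapping.lookup (S ^ K * (\<Prod>j=1..d. y j ^ (\<Sum>i=1..d. g i j))) n"
      by (simp add: lookup_Const_mult)
    moreover have "multi_fact d n *
        Poly_Mapping.lookup (S ^ K * (\<Prod>j=1..d. y j ^ (\<Sum>i=1..d. g i j))) n *
        pochhammer (- of_nat N) s =
      fact N * multi_power d q n * (\<Prod>j=1..d. pochhammer (- of_nat (?n j)) (\<Sum>i=1..d. g i j))"
      unfolding S_def y_def s_def using n K
      by (intro lookup_power_sum_Var_mult_monomial) (simp_all add: s_def)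
    \<comment> \<open>Here \<open>s \<le> N\<close>, so the denominator in the Krawtchouk term is a
      true one and can be cleared.\<close>
    moreover have "pochhammer (- of_nat N :: complex) s \<noteq> 0"
      using K by (intro pochhammer_of_nat_eq_0_lemma') simp
    moreover have "(\<Prod>i=1..d. c i (g i) * (\<Prod>j=1..d. \<omega> i j ^ g i j)) =
      (\<Prod>i=1..d. pochhammer (- of_nat (?nt i)) (\<Sum>j=1..d. g i j)) *
      (\<Prod>i=1..d. \<Prod>j=1..d. \<omega> i j ^ g i j / fact (g i j))"
      unfolding prod.distrib[symmetric] c_def
      by (intro prod.cong refl) (simp add: prod_dividef)
    \<comment> \<open>The facts above combine by plain algebra: \<open>L'\<close> and
      \<open>L\<close> are the two coefficients, \<open>p\<close> is the symbol of
      \<open>- N\<close>, \<open>D\<close> and \<open>A\<close> are the column and row symbols, and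
      \<open>B\<close> is the product of the weights.\<close>
    moreover have "e * (D * A / p * B) = m * L'"
      if "L' = C * L" "m * L * p = e * D" "p \<noteq> 0" "C = A * B" for m L p e D A B C L' :: complex
      using that by (simp add: field_simps)
    ultimately show ?thesis
      unfolding s by blast
  qed
  have drop: "(\<Prod>j=1..d. pochhammer (- of_nat (drop_zeroth d w j)) (e j)) =
      (\<Prod>j=1..d. pochhammer (- of_nat (Poly_Mapping.lookup w j) :: complex) (e j))" for w e
    by (intro prod.cong) (auto simp: drop_zeroth_def)
  have "fact N * multi_power d q n * krawtchouk d N U (drop_zeroth d n) (drop_zeroth d nt) =
    multi_fact d n * Poly_Mapping.lookup
      (multi_power d (\<lambda>i. \<Sum>j=0..d. Const (U $$ (i, j)) * y j) nt) n"
    unfolding krawtchouk_eq_sum_rows drop expand lookup_sum sum_distrib_left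
    by (intro sum.cong refl) (simp only: term_eq \<omega>_def[symmetric])
  then show ?thesis by (simp only: y_def)
qed

section \<open>From the bilinear form to coefficients\<close>

lemma diagonal_mat_entry_nonzero:
  assumes "diagonal_mat D" "D \<in> carrier_mat k k" "det D \<noteq> 0" "i < k"
  shows "D $$ (i, i) \<noteq> (0 :: 'a :: idom)"
proof -
  have "upper_triangular D"
    using assms by (auto simp: diagonal_mat_def)
  then have "0 \<notin> set (diag_mat D)"
    using assms(2,3) det_upper_triangular[of D k] by (simp add: prod_list_zero_iff)
  then show ?thesis
    using assms(2,4) by (force simp: diag_mat_def)
qed

text \<open>Monomials are orthogonal, so pairing with one reads off a coefficient; this links the
  form to the generating function.\<close>

lemma bform_multi_power_Var_left:
  assumes "n \<in> multi_indices d N"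
  shows "bform d N Pt \<theta> (multi_power d Var n) f =
    Poly_Mapping.lookup f n * (multi_fact d n / multi_power d (\<lambda>i. Pt $$ (i, i)) n * \<theta> ^ N)"
proof -
  have "multi_power d Var n = Poly_Mapping.single n 1"
    using assms by (auto simp: multi_indices_def multi_power_Var)
  then have "bform d N Pt \<theta> (multi_power d Var n) f = (\<Sum>l\<in>multi_indices d N. if n = l
      then Poly_Mapping.lookup f n * (multi_fact d n / multi_power d (\<lambda>i. Pt $$ (i, i)) n * \<theta> ^ N)
      else 0)"
    unfolding bform_def by (intro sum.cong refl) (auto simp: lookup_single when_def)
  then show ?thesis using assms by (simp add: finite_multi_indices)
qed

theorem corollary5p2:
  fixes d N :: nat
    and \<nu> \<theta> \<theta>t :: complex
    and P Pt U R :: "complex mat"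
    and n nt :: multi_index
  assumes "d \<ge> 1" and "N \<ge> 1"
    and "(\<nu>, P, Pt, U) \<in> krawtchouk_params d"
    and "R = \<theta>t \<cdot>\<^sub>m (Pt * transpose_mat U)"
    and "det R = 1"
    and "\<theta> = \<nu> / \<theta>t"
    and "n \<in> multi_indices d N" and "nt \<in> multi_indices d N"
  shows "krawtchouk d N U (drop_zeroth d n) (drop_zeroth d nt) =
    1 / (\<nu> ^ N * fact N) *
      bform d N Pt \<theta> (multi_power d Var n) (multi_power d (Var_tilde d R) nt)"
proof -
  define q where "q i = Pt $$ (i, i)" for i
  define Y where "Y i = (\<Sum>j=0..d. Const (U $$ (i, j)) * (Const (q j) * Var j))" for i
  have carrier: "Pt \<in> carrier_mat (d + 1) (d + 1)" "U \<in> carrier_mat (d + 1) (d + 1)"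
    and diag: "diagonal_mat Pt"
    and U: "\<And>j. j \<le> d \<Longrightarrow> U $$ (0, j) = 1" "\<And>i. i \<le> d \<Longrightarrow> U $$ (i, 0) = 1"
    and \<nu>: "\<nu> \<noteq> 0"
    using assms(3) by (auto simp: krawtchouk_params_def)
  \<comment> \<open>Multiplicativity of the determinant extracts from \<open>det R = 1\<close> that
    \<open>\<theta>t\<close> and the diagonal of \<open>Pt\<close> do not vanish, so the divisions
    in \<open>\<theta>\<close> and in the form are genuine.\<close>
  have "\<theta>t ^ (d + 1) * (det Pt * det (transpose_mat U)) = 1"
    using assms(4,5) carrier by (simp add: det_mult[of _ "d + 1"])
  then have \<theta>t: "\<theta>t \<noteq> 0" and "det Pt \<noteq> 0"
    by auto
  then have "q i \<noteq> 0" if "i \<le> d" for i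
    unfolding q_def using that diag carrier
    by (intro diagonal_mat_entry_nonzero[of Pt "d + 1"]) auto
  then have q: "multi_power d q n \<noteq> 0"
    by (auto simp: multi_power_def)
  have R: "R $$ (i, j) = \<theta>t * (U $$ (j, i) * q i)" if "i \<le> d" "j \<le> d" for i j
  proof -
    have "(Pt * transpose_mat U) $$ (i, j) = (\<Sum>k=0..<d + 1. Pt $$ (i, k) * U $$ (j, k))"
      using that carrier by (auto simp: scalar_prod_def intro!: sum.cong)
    also have "\<dots> = (\<Sum>k=0..<d + 1. if k = i then Pt $$ (i, i) * U $$ (j, i) else 0)"
      using that carrier diag by (intro sum.cong refl) (auto simp: diagonal_mat_def)
    finally show ?thesis
      using that carrier by (simp add: assms(4) q_def mult.commute)
  qed
  \<comment> \<open>By the transposition in \<open>R\<close>, its column \<open>j\<close> is row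
    \<open>j\<close> of \<open>U\<close> weighted by \<open>q\<close>, up to the scalar
    \<open>\<theta>t\<close>.\<close>
  have "Var_tilde d R j = Const \<theta>t * Y j" if "j \<le> d" for j
    using that
    by (auto simp: Var_tilde_def Y_def R Const_mult sum_distrib_left mult_ac intro!: sum.cong)
  then have "multi_power d (Var_tilde d R) nt = multi_power d (\<lambda>j. Const \<theta>t * Y j) nt"
    by (simp add: multi_power_def)
  also have "\<dots> = Const (\<theta>t ^ N) * multi_power d Y nt"
    using assms(8)
    by (simp add: multi_power_def power_mult_distrib prod.distrib Const_power multi_indices_def
        flip: power_sum)
  \<comment> \<open>Homogeneity of degree \<open>N\<close> has released
    \<open>\<theta>t ^ N\<close>, which meets the \<open>\<theta> ^ N\<close> of the form; the
    product is \<open>\<nu> ^ N\<close>.\<close>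
  finally have "bform d N Pt \<theta> (multi_power d Var n) (multi_power d (Var_tilde d R) nt) =
      (\<theta>t * \<theta>) ^ N * (multi_fact d n * Poly_Mapping.lookup (multi_power d Y nt) n) / multi_power d q n"
    by (simp add: bform_multi_power_Var_left[OF assms(7)] lookup_Const_mult q_def[abs_def]
        power_mult_distrib)
  also have "multi_fact d n * Poly_Mapping.lookup (multi_power d Y nt) n =
      fact N * multi_power d q n * krawtchouk d N U (drop_zeroth d n) (drop_zeroth d nt)"
    unfolding Y_def by (rule krawtchouk_eq_coefficient[OF U assms(7,8), symmetric])
  also have "\<theta>t * \<theta> = \<nu>"
    using \<theta>t by (simp add: assms(6))
  finally show ?thesis
    using \<nu> q by simp
qed

end
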